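(* If $1\leq a<b<c<d$ are integers with $ad=bc$, then $$\binom{b+c}{b} \, \geq \, \binom{a+d}{a} \, .$$
   Context: $\binom{m}{n}$ denotes the usual binomial coefficient. *)

theory Defs
  imports Complex_Main
begin

end

theory Submission
  imports Defs
begin

text \<open>
  By Vandermonde, \<open>(m + n) choose m = (\<Sum>k. (m choose k) * (n choose k))\<close>, and the two sums compare
  term by term: up to the common factor \<open>(k!)\<^sup>2\<close> the terms are products of factors
  \<open>(b - j) * (c - j)\<close> and \<open>(a - j) * (d - j)\<close> respectively, and these are ordered because
  \<open>a * d = b * c\<close> forces \<open>b + c \<le> a + d\<close>.
\<close>

lemma vandermonde_diagonal:
  "(m + n) choose m = (\<Sum>k\<le>m. (m choose k) * (n choose k))"
proof -
  have "(m + n) choose m = (\<Sum>k\<le>m. (n choose k) * (m choose (m - k)))"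
    by (simp add: vandermonde add.commute)
  also have "\<dots> = (\<Sum>k\<le>m. (m choose k) * (n choose k))"
    by (rule sum.cong) (auto simp: binomial_symmetric[symmetric])
  finally show ?thesis .
qed

lemma Suc_times_binomial_Suc:
  "Suc k * (n choose Suc k) = (n - k) * (n choose k)"
  by (simp only: binomial_absorption binomial_absorb_comp)

text \<open>Multiplied by \<open>a\<close>, the gap between the two sides is
  \<open>(b - a) * (c - a)\<close>.\<close>

lemma sum_le_sum_of_mult_eq:
  fixes a b c d :: nat
  assumes "0 < a" "a \<le> b" "a \<le> c" "a * d = b * c"
  shows "b + c \<le> a + d"
proof -
  obtain x y where xy: "b = a + x" "c = a + y"
    using assms by (auto simp: le_iff_add)
  have "a * (b + c) + x * y = a * (a + d)"
    using assms(4) xy by (simp add: algebra_simps)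
  then have "a * (b + c) \<le> a * (a + d)"
    by linarith
  then show ?thesis
    using assms(1) by simp
qed

text \<open>For \<open>j \<ge> a\<close> truncated subtraction makes the left side zero. Otherwise
  expand over the integers: the products agree, and only
  \<open>j * (b + c) \<le> j * (a + d)\<close> remains.\<close>

lemma shifted_mult_le:
  fixes a b c d j :: nat
  assumes "a \<le> b" "a \<le> c" "b + c \<le> a + d" "a * d = b * c"
  shows "(a - j) * (d - j) \<le> (b - j) * (c - j)"
proof (cases "j < a")
  case True
  then have le: "j \<le> a" "j \<le> b" "j \<le> c" "j \<le> d"
    using assms by auto
  have "int a * int d = int b * int c"
    using assms(4) by (metis of_nat_mult)
  moreover have "int j * (int b + int c) \<le> int j * (int a + int d)"
    using assms(3) by (intro mult_left_mono) auto
  ultimately have "(int a - int j) * (int d - int j) \<le> (int b - int j) * (int c - int j)"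
    by (simp add: algebra_simps)
  then show ?thesis
    using le by (simp flip: of_nat_diff of_nat_mult)
qed simp

lemma binomial_mult_le:
  fixes a b c d k :: nat
  assumes "a \<le> b" "a \<le> c" "b + c \<le> a + d" "a * d = b * c"
  shows "(a choose k) * (d choose k) \<le> (b choose k) * (c choose k)"
proof (induction k)
  case (Suc k)
  \<comment> \<open>Scaling by \<open>Suc k * Suc k\<close> avoids division: each side becomes its
    predecessor times one shifted product.\<close>
  have step: "(Suc k * Suc k) * ((m choose Suc k) * (n choose Suc k))
      = ((m - k) * (n - k)) * ((m choose k) * (n choose k))" for m n
  proof -
    have "(Suc k * Suc k) * ((m choose Suc k) * (n choose Suc k))
        = (Suc k * (m choose Suc k)) * (Suc k * (n choose Suc k))"
      by (simp only: ac_simps)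
    then show ?thesis
      by (simp only: Suc_times_binomial_Suc ac_simps)
  qed
  have "(Suc k * Suc k) * ((a choose Suc k) * (d choose Suc k))
      \<le> (Suc k * Suc k) * ((b choose Suc k) * (c choose Suc k))"
    unfolding step by (intro mult_le_mono shifted_mult_le assms Suc.IH)
  then show ?case
    by (simp only: mult_le_cancel1) simp
qed simp

theorem theorem1:
  fixes a b c d :: nat
  assumes "1 \<le> a" and "a < b" and "b < c" and "c < d"
    and "a * d = b * c"
  shows "(b + c) choose b \<ge> (a + d) choose a"
proof -
  have "b + c \<le> a + d"
    using assms by (intro sum_le_sum_of_mult_eq) auto
  then have "(\<Sum>k\<le>a. (a choose k) * (d choose k)) \<le> (\<Sum>k\<le>a. (b choose k) * (c choose k))"
    using assms by (intro sum_mono binomial_mult_le) auto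
  \<comment> \<open>The Vandermonde sum for \<open>b + c\<close> runs up to \<open>b\<close>; the
    terms beyond \<open>a\<close> are nonnegative.\<close>
  also have "\<dots> \<le> (\<Sum>k\<le>b. (b choose k) * (c choose k))"
    using assms by (intro sum_mono2) auto
  finally show ?thesis
    by (simp only: vandermonde_diagonal)
qed

end
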